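(* For $s=2l\in\mathbb Z_{\ge0}$ the $U_q(\mathfrak{osp}(2|1))$-module $W_s=V_s\otimes\mathbb C^{1|1}$ decomposes as $$W_s=W_s^+\oplus W_s^-,$$ where $W_s^\pm$ has highest weight vector $w_s^\pm=e^l_l\otimes|\pm\rangle$ and is spanned by $$W_s^\pm=\mathrm{span}\{w_s^\pm,\ \mathcal F w_s^\pm,\ \mathcal F^2w_s^\pm,\dots,\mathcal F^{s}w_s^\pm\}.$$ The two summands are irreducible representations which have equal dimensions and differ by the parity of the highest weight vector.
   Context: $q=e^{\pi i b^2}$, $q_*:=-iq=e^{\pi i b_*^2}$ with $b^2=b_*^2+\frac12$; $[n]_{p}=\frac{p^n-p^{-n}}{p-p^{-1}}$. $U_q(\mathfrak{osp}(2|1))$ is the superalgebra generated by an even element $\mathcal K$ (invertible) and odd elements $\mathcal E,\mathcal F$ with $\mathcal E\mathcal F+\mathcal F\mathcal E=\frac{\mathcal K-\mathcal K^{-1}}{q+q^{-1}}$, $\mathcal K\mathcal E=q^2\mathcal E\mathcal K$, $\mathcal K\mathcal F=q^{-2}\mathcal F\mathcal K$. $\mathbb C^{1|1}$ has even basis vector $|+\rangle$ and odd basis vector $|-\rangle$; the odd Clifford generators $\xi,\eta$ ($\xi^2=\eta^2=1$, $\xi\eta=-\eta\xi$) act by $\xi|\pm\rangle=|\mp\rangle$, $\eta|+\rangle=-i|-\rangle$, $\eta|-\rangle=i|+\rangle$. $V_s$ ($s=2l$) is the $(s+1)$-dimensional $U_{q_*}(\mathfrak{sl}(2))$-module with basis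 $e^l_m$, $m=-l,\dots,l$, and $Ke^l_m=q_*^{2m}e^l_m$, $Ee^l_m=[l-m]_{q_*}e^l_{m+1}$, $Fe^l_m=[l+m]_{q_*}e^l_{m-1}$. The generators of $U_q(\mathfrak{osp}(2|1))$ act on $V_s\otimes\mathbb C^{1|1}$ by $\mathcal E=\xi E$, $\mathcal F=\eta F$, $\mathcal K=i\xi\eta K$; the vector $e^l_m\otimes|+\rangle$ is even and $e^l_m\otimes|-\rangle$ is odd.
   Formalization: Genericity is added: q_*^2 ≠ 1 (else [n] and 1/(q+q^{-1}) are undefined) and q_*^{2n} ≠ 1 for 1 ≤ n ≤ s; otherwise some [n]=0, F^{s-n+1}w=0, and the spans do not fill W_s (e.g. b=1, s=2). *)

theory Defs
  imports Complex_Main "HOL-Library.Function_Algebras"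
begin

text \<open>
  All vector spaces live inside the complex vector spaces of functions from a basis index type
  \<open>'x\<close> to the complex numbers.
\<close>

definition cscale :: "complex \<Rightarrow> ('x \<Rightarrow> complex) \<Rightarrow> 'x \<Rightarrow> complex" (infixr "*\<^sub>c" 75) where
  "c *\<^sub>c v = (\<lambda>x. c * v x)"

global_interpretation cfun: vector_space "cscale :: complex \<Rightarrow> ('x \<Rightarrow> complex) \<Rightarrow> 'x \<Rightarrow> complex"
  by unfold_locales (simp_all add: cscale_def fun_eq_iff plus_fun_def algebra_simps)

definition bvec :: "'x \<Rightarrow> 'x \<Rightarrow> complex" where
  "bvec x = (\<lambda>y. if y = x then 1 else 0)"

text \<open>The linear operator sending \<open>bvec x\<close> to \<open>\<phi> x\<close> for \<open>x\<close> in the finite set \<open>B\<close>, and the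
  remaining basis vectors to \<open>0\<close>.\<close>

definition lin_ext :: "'x set \<Rightarrow> ('x \<Rightarrow> 'y \<Rightarrow> complex) \<Rightarrow> ('x \<Rightarrow> complex) \<Rightarrow> 'y \<Rightarrow> complex" where
  "lin_ext B \<phi> v = (\<Sum>x\<in>B. v x *\<^sub>c \<phi> x)"

definition linear_on_space ::
    "('x \<Rightarrow> complex) set \<Rightarrow> (('x \<Rightarrow> complex) \<Rightarrow> ('x \<Rightarrow> complex)) \<Rightarrow> bool" where
  "linear_on_space W f \<longleftrightarrow>
     (\<forall>u\<in>W. \<forall>v\<in>W. f (u + v) = f u + f v) \<and> (\<forall>c. \<forall>u\<in>W. f (c *\<^sub>c u) = c *\<^sub>c f u)"

definition direct_sum_decomp ::
    "('x \<Rightarrow> complex) set \<Rightarrow> ('x \<Rightarrow> complex) set \<Rightarrow> ('x \<Rightarrow> complex) set \<Rightarrow> bool" where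
  "direct_sum_decomp W A B \<longleftrightarrow>
     cfun.subspace A \<and> cfun.subspace B \<and> W = {a + b |a b. a \<in> A \<and> b \<in> B} \<and> A \<inter> B = {0}"


text \<open>
  A module over \<open>U\<^sub>q(osp(2|1))\<close> is a \<open>\<int>/2\<close>-graded space \<open>W = W0 \<oplus> W1\<close> with an even
  invertible operator \<open>K\<close> and odd operators \<open>E\<close>, \<open>F\<close> satisfying the defining relations.
  The generator inverse to \<open>K\<close> acts by \<open>inv_into W K\<close>.
\<close>

definition uq_osp_module ::
    "complex \<Rightarrow> ('x \<Rightarrow> complex) set \<Rightarrow> ('x \<Rightarrow> complex) set \<Rightarrow> ('x \<Rightarrow> complex) set \<Rightarrow>
     (('x \<Rightarrow> complex) \<Rightarrow> ('x \<Rightarrow> complex)) \<Rightarrow> (('x \<Rightarrow> complex) \<Rightarrow> ('x \<Rightarrow> complex)) \<Rightarrow>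
     (('x \<Rightarrow> complex) \<Rightarrow> ('x \<Rightarrow> complex)) \<Rightarrow> bool" where
  "uq_osp_module q W W0 W1 E F K \<longleftrightarrow>
     direct_sum_decomp W W0 W1 \<and>
     linear_on_space W E \<and> linear_on_space W F \<and> linear_on_space W K \<and>
     E ` W0 \<subseteq> W1 \<and> E ` W1 \<subseteq> W0 \<and> F ` W0 \<subseteq> W1 \<and> F ` W1 \<subseteq> W0 \<and>
     K ` W0 \<subseteq> W0 \<and> K ` W1 \<subseteq> W1 \<and> bij_betw K W W \<and>
     (\<forall>v\<in>W. E (F v) + F (E v) = (1 / (q + inverse q)) *\<^sub>c (K v - inv_into W K v)) \<and>
     (\<forall>v\<in>W. K (E v) = (q powi 2) *\<^sub>c E (K v)) \<and>
     (\<forall>v\<in>W. K (F v) = (q powi (-2)) *\<^sub>c F (K v))"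

definition uq_submodule ::
    "('x \<Rightarrow> complex) set \<Rightarrow> ('x \<Rightarrow> complex) set \<Rightarrow>
     (('x \<Rightarrow> complex) \<Rightarrow> ('x \<Rightarrow> complex)) \<Rightarrow> (('x \<Rightarrow> complex) \<Rightarrow> ('x \<Rightarrow> complex)) \<Rightarrow>
     (('x \<Rightarrow> complex) \<Rightarrow> ('x \<Rightarrow> complex)) \<Rightarrow> bool" where
  "uq_submodule U W E F K \<longleftrightarrow>
     cfun.subspace U \<and> U \<subseteq> W \<and>
     E ` U \<subseteq> U \<and> F ` U \<subseteq> U \<and> K ` U \<subseteq> U \<and> inv_into W K ` U \<subseteq> U"

text \<open>Arbitrary submodules are excluded here, not only those compatible with the grading; in
  particular this implies irreducibility as a graded module.\<close>

definition uq_irreducible ::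
    "('x \<Rightarrow> complex) set \<Rightarrow>
     (('x \<Rightarrow> complex) \<Rightarrow> ('x \<Rightarrow> complex)) \<Rightarrow> (('x \<Rightarrow> complex) \<Rightarrow> ('x \<Rightarrow> complex)) \<Rightarrow>
     (('x \<Rightarrow> complex) \<Rightarrow> ('x \<Rightarrow> complex)) \<Rightarrow> bool" where
  "uq_irreducible W E F K \<longleftrightarrow>
     W \<noteq> {0} \<and> (\<forall>U. uq_submodule U W E F K \<longrightarrow> U = {0} \<or> U = W)"

definition highest_weight_vector ::
    "('x \<Rightarrow> complex) set \<Rightarrow>
     (('x \<Rightarrow> complex) \<Rightarrow> ('x \<Rightarrow> complex)) \<Rightarrow> (('x \<Rightarrow> complex) \<Rightarrow> ('x \<Rightarrow> complex)) \<Rightarrow>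
     ('x \<Rightarrow> complex) \<Rightarrow> bool" where
  "highest_weight_vector W E K w \<longleftrightarrow>
     w \<in> W \<and> w \<noteq> 0 \<and> E w = 0 \<and> (\<exists>c. K w = c *\<^sub>c w)"


text \<open>The quotient is meaningful only for \<open>p\<^sup>2 \<noteq> 1\<close>; then \<open>qint p n = 0\<close> for \<open>n \<ge> 1\<close> iff
  \<open>p ^ (2 * n) = 1\<close>. If \<open>qint p n = 0\<close> for some \<open>n\<close> with \<open>1 \<le> n \<le> s\<close>, the vectors \<open>F ^ j w\<close>, \<open>j \<le> s\<close>,
  no longer span complementary summands.\<close>

definition qint :: "complex \<Rightarrow> int \<Rightarrow> complex" where
  "qint p n = (p powi n - p powi (- n)) / (p - inverse p)"

text \<open>
  The module \<open>V\<^sub>s\<close>, \<open>s = 2l\<close>: the basis vector \<open>e\<^sup>l\<^sub>m\<close> is \<open>bvec k\<close> with \<open>k = l + m \<in> {0..s}\<close>,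
  so that \<open>l - m = s - k\<close> and \<open>2m = 2k - s\<close>. At the lower end \<open>k = 0\<close> the truncated \<open>k - 1\<close>
  is harmless because its coefficient is \<open>qint p 0 = 0\<close>.
\<close>

definition sl_K :: "complex \<Rightarrow> nat \<Rightarrow> (nat \<Rightarrow> complex) \<Rightarrow> nat \<Rightarrow> complex" where
  "sl_K p s = lin_ext {..s} (\<lambda>k. (p powi (2 * int k - int s)) *\<^sub>c bvec k)"

definition sl_E :: "complex \<Rightarrow> nat \<Rightarrow> (nat \<Rightarrow> complex) \<Rightarrow> nat \<Rightarrow> complex" where
  "sl_E p s = lin_ext {..s} (\<lambda>k. qint p (int s - int k) *\<^sub>c bvec (k + 1))"

definition sl_F :: "complex \<Rightarrow> nat \<Rightarrow> (nat \<Rightarrow> complex) \<Rightarrow> nat \<Rightarrow> complex" where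
  "sl_F p s = lin_ext {..s} (\<lambda>k. qint p (int k) *\<^sub>c bvec (k - 1))"

datatype ket = Plus | Minus

definition cl_xi :: "(ket \<Rightarrow> complex) \<Rightarrow> ket \<Rightarrow> complex" where
  "cl_xi = lin_ext {Plus, Minus} (\<lambda>a. case a of Plus \<Rightarrow> bvec Minus | Minus \<Rightarrow> bvec Plus)"

definition cl_eta :: "(ket \<Rightarrow> complex) \<Rightarrow> ket \<Rightarrow> complex" where
  "cl_eta = lin_ext {Plus, Minus}
     (\<lambda>a. case a of Plus \<Rightarrow> (- \<i>) *\<^sub>c bvec Minus | Minus \<Rightarrow> \<i> *\<^sub>c bvec Plus)"

text \<open>
  The tensor product of \<open>V\<^sub>s\<close> and \<open>\<complex>\<^sup>1\<^sup>|\<^sup>1\<close> has basis indexed by \<open>{..s} \<times> {Plus, Minus}\<close>.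
  Since \<open>V\<^sub>s\<close> is purely even, no signs occur in the tensor product of operators.
\<close>

definition tensor :: "('x \<Rightarrow> complex) \<Rightarrow> ('y \<Rightarrow> complex) \<Rightarrow> 'x \<times> 'y \<Rightarrow> complex" where
  "tensor v u = (\<lambda>(x, y). v x * u y)"

definition tensor_op ::
    "nat \<Rightarrow> ((nat \<Rightarrow> complex) \<Rightarrow> nat \<Rightarrow> complex) \<Rightarrow> ((ket \<Rightarrow> complex) \<Rightarrow> ket \<Rightarrow> complex) \<Rightarrow>
     (nat \<times> ket \<Rightarrow> complex) \<Rightarrow> nat \<times> ket \<Rightarrow> complex" where
  "tensor_op s A B =
     lin_ext ({..s} \<times> {Plus, Minus}) (\<lambda>(k, a). tensor (A (bvec k)) (B (bvec a)))"

definition W_even :: "nat \<Rightarrow> (nat \<times> ket \<Rightarrow> complex) set" where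
  "W_even s = cfun.span {tensor (bvec k) (bvec Plus) |k. k \<le> s}"

definition W_odd :: "nat \<Rightarrow> (nat \<times> ket \<Rightarrow> complex) set" where
  "W_odd s = cfun.span {tensor (bvec k) (bvec Minus) |k. k \<le> s}"

definition W_mod :: "nat \<Rightarrow> (nat \<times> ket \<Rightarrow> complex) set" where
  "W_mod s = cfun.span {tensor (bvec k) (bvec a) |k a. k \<le> s}"

definition osp_E :: "complex \<Rightarrow> nat \<Rightarrow> (nat \<times> ket \<Rightarrow> complex) \<Rightarrow> nat \<times> ket \<Rightarrow> complex" where
  "osp_E p s = tensor_op s (sl_E p s) cl_xi"

definition osp_F :: "complex \<Rightarrow> nat \<Rightarrow> (nat \<times> ket \<Rightarrow> complex) \<Rightarrow> nat \<times> ket \<Rightarrow> complex" where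
  "osp_F p s = tensor_op s (sl_F p s) cl_eta"

definition osp_K :: "complex \<Rightarrow> nat \<Rightarrow> (nat \<times> ket \<Rightarrow> complex) \<Rightarrow> nat \<times> ket \<Rightarrow> complex" where
  "osp_K p s v = \<i> *\<^sub>c tensor_op s (sl_K p s) (cl_xi \<circ> cl_eta) v"

definition hw_vec :: "nat \<Rightarrow> ket \<Rightarrow> nat \<times> ket \<Rightarrow> complex" where
  "hw_vec s a = tensor (bvec s) (bvec a)"

definition W_summand :: "complex \<Rightarrow> nat \<Rightarrow> ket \<Rightarrow> (nat \<times> ket \<Rightarrow> complex) set" where
  "W_summand p s a = cfun.span {(osp_F p s ^^ j) (hw_vec s a) |j. j \<le> s}"

end

(*
  In the coordinates v (k, a) the summand with highest weight vector bvec (s, a) is the coordinate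
  subspace of those basis vectors e_k (x) |c> with c = a exactly when s - k is even. For
  irreducibility, the eigenvalues of K on a summand are (up to a common factor) the powers
  (- p^2)^k, and these may coincide, so E is used instead: if e_k is the lowest vector occurring in
  a nonzero v, then E^(s - k) v is a nonzero multiple of the highest weight vector, from which F
  generates the summand.
*)
theory Submission
  imports Defs
begin

section \<open>Coordinate subspaces\<close>

text \<open>The modules and their graded parts are all of this form, and so are the two summands
  once the relevant q-numbers are nonzero. Sums, intersections, dimensions and invariance thereby
  become statements about index sets.\<close>

definition coord_subspace :: "'x set \<Rightarrow> ('x \<Rightarrow> complex) set" where
  "coord_subspace S = {v. \<forall>x. x \<notin> S \<longrightarrow> v x = 0}"

lemma sum_fun_apply: "(\<Sum>x\<in>B. f x) y = (\<Sum>x\<in>B. (f x y :: complex))"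
  by (induction B rule: infinite_finite_induct) auto

lemma subspace_coord_subspace: "cfun.subspace (coord_subspace S)"
  by (auto simp: cfun.subspace_def coord_subspace_def cscale_def)

lemma coord_subspace_Int: "coord_subspace S \<inter> coord_subspace T = coord_subspace (S \<inter> T)"
  by (auto simp: coord_subspace_def)

lemma bvec_apply: "bvec x y = (if y = x then 1 else 0)"
  by (simp add: bvec_def)

lemma bvec_in_coord_subspace: "x \<in> S \<Longrightarrow> bvec x \<in> coord_subspace S"
  by (auto simp: coord_subspace_def bvec_def)

lemma coord_subspace_expand:
  assumes "finite S" "v \<in> coord_subspace S"
  shows "v = (\<Sum>x\<in>S. v x *\<^sub>c bvec x)"
proof
  fix y
  have "(\<Sum>x\<in>S. v x * bvec x y) = (\<Sum>x\<in>S. if x = y then v x else 0)"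
    by (rule sum.cong) (auto simp: bvec_def)
  then show "v y = (\<Sum>x\<in>S. v x *\<^sub>c bvec x) y"
    using assms by (simp add: sum_fun_apply cscale_def coord_subspace_def)
qed

lemma span_bvec:
  assumes "finite S"
  shows "cfun.span (bvec ` S) = coord_subspace S"
proof
  show "cfun.span (bvec ` S) \<subseteq> coord_subspace S"
    by (rule cfun.span_minimal) (auto simp: subspace_coord_subspace bvec_in_coord_subspace)
  show "coord_subspace S \<subseteq> cfun.span (bvec ` S)"
  proof
    fix v assume "v \<in> coord_subspace S"
    then have "v = (\<Sum>x\<in>S. v x *\<^sub>c bvec x)"
      by (rule coord_subspace_expand[OF assms])
    also have "\<dots> \<in> cfun.span (bvec ` S)"
      by (intro cfun.span_sum cfun.span_scale cfun.span_base) auto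
    finally show "v \<in> cfun.span (bvec ` S)" .
  qed
qed

lemma inj_bvec: "inj bvec"
  by (rule injI) (auto simp: bvec_def fun_eq_iff split: if_splits)

text \<open>A dependence would put some \<open>bvec x\<close> into the span of the other basis
  vectors, whose elements all vanish at \<open>x\<close>.\<close>

lemma dim_coord_subspace:
  assumes "finite S"
  shows "cfun.dim (coord_subspace S) = card S"
proof -
  have "cfun.independent (bvec ` S)"
  proof
    assume "cfun.dependent (bvec ` S)"
    then obtain x where x: "x \<in> S" "bvec x \<in> cfun.span (bvec ` S - {bvec x})"
      by (auto simp: cfun.dependent_def)
    have "bvec ` S - {bvec x} = bvec ` (S - {x})"
      by (simp add: image_set_diff[OF inj_bvec])
    with x(2) have "bvec x \<in> coord_subspace (S - {x})"
      using assms by (simp add: span_bvec)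
    then show False
      by (simp add: coord_subspace_def bvec_def) (metis zero_neq_one)
  qed
  then have "cfun.dim (cfun.span (bvec ` S)) = card (bvec ` S)"
    by (rule cfun.dim_span_eq_card_independent)
  also have "\<dots> = card S"
    by (rule card_image) (rule inj_on_subset[OF inj_bvec], simp)
  finally show ?thesis
    by (simp add: span_bvec[OF assms])
qed

lemma direct_sum_coord_subspace:
  assumes "S = A \<union> B" "A \<inter> B = {}"
  shows "direct_sum_decomp (coord_subspace S) (coord_subspace A) (coord_subspace B)"
proof -
  have "\<exists>a b. v = a + b \<and> a \<in> coord_subspace A \<and> b \<in> coord_subspace B"
    if "v \<in> coord_subspace S" for v
    using that assms
    \<comment> \<open>The two components are the restrictions of \<open>v\<close> to
      \<open>A\<close> and to its complement; the second vanishes outside \<open>B\<close> because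
      \<open>S\<close> is covered by \<open>A\<close> and \<open>B\<close>.\<close>
    by (intro exI[of _ "\<lambda>x. if x \<in> A then v x else 0"] exI[of _ "\<lambda>x. if x \<in> A then 0 else v x"])
       (auto simp: coord_subspace_def fun_eq_iff)
  moreover have "coord_subspace A \<inter> coord_subspace B = {0}"
    using assms(2) by (simp add: coord_subspace_Int) (auto simp: coord_subspace_def fun_eq_iff)
  ultimately show ?thesis
    using assms(1) unfolding direct_sum_decomp_def
    by (auto simp: subspace_coord_subspace) (auto simp: coord_subspace_def)
qed

section \<open>The operators in coordinates\<close>

fun flip :: "ket \<Rightarrow> ket" where
  "flip Plus = Minus" | "flip Minus = Plus"

text \<open>The eigenvalue of i xi eta on the ket, which is its parity sign.\<close>

fun ksign :: "ket \<Rightarrow> complex" where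
  "ksign Plus = 1" | "ksign Minus = -1"

lemma ksign_simps [simp]: "ksign a * ksign a = 1" "ksign (flip a) = - ksign a" "flip (flip a) = a"
  "flip a \<noteq> a" "a \<noteq> flip a" "ksign a \<noteq> 0"
  by (cases a; simp)+

lemma lin_ext_bvec:
  assumes "finite B"
  shows "lin_ext B \<phi> (bvec x) = (if x \<in> B then \<phi> x else 0)"
proof
  fix y
  have "(\<Sum>z\<in>B. bvec x z * \<phi> z y) = (\<Sum>z\<in>B. if z = x then \<phi> z y else 0)"
    by (rule sum.cong) (auto simp: bvec_def)
  then show "lin_ext B \<phi> (bvec x) y = (if x \<in> B then \<phi> x else 0) y"
    using assms by (simp add: lin_ext_def sum_fun_apply cscale_def)
qed

lemma tensor_bvec: "tensor (bvec k) (bvec a) = bvec (k, a)"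
  by (auto simp: tensor_def bvec_def fun_eq_iff)

lemma cl_xi_bvec: "cl_xi (bvec a) = bvec (flip a)"
  by (cases a) (simp_all add: cl_xi_def lin_ext_bvec)

lemma cl_eta_bvec: "cl_eta (bvec a) = (- \<i> * ksign a) *\<^sub>c bvec (flip a)"
  by (cases a) (simp_all add: cl_eta_def lin_ext_bvec)

lemma cl_xi_eta_bvec: "cl_xi (cl_eta (bvec a)) = (- \<i> * ksign a) *\<^sub>c bvec a"
proof -
  have "cl_xi (c *\<^sub>c v) = c *\<^sub>c cl_xi v" for c v
    by (simp add: cl_xi_def lin_ext_def cscale_def fun_eq_iff algebra_simps)
  then show ?thesis
    by (simp only: cl_eta_bvec cl_xi_bvec ksign_simps)
qed

section \<open>Coordinate formulas for the generators\<close>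

lemma tensor_op_apply:
  "tensor_op s A B v (k', a') =
     (\<Sum>k\<le>s. \<Sum>a\<in>{Plus, Minus}. v (k, a) * (A (bvec k) k' * B (bvec a) a'))"
  unfolding tensor_op_def lin_ext_def sum_fun_apply sum.cartesian_product
  by (simp add: cscale_def tensor_def case_prod_unfold)

lemma qint_0 [simp]: "qint p 0 = 0"
  by (simp add: qint_def)

lemma osp_E_apply:
  "osp_E p s v (k, a) = (if 0 < k \<and> k \<le> s then qint p (int s - int k + 1) * v (k - 1, flip a) else 0)"
proof -
  have "osp_E p s v (k, a) = (\<Sum>j\<le>s. if k - 1 = j \<and> 0 < k then qint p (int s - int j) * v (j, flip a) else 0)"
    unfolding osp_E_def tensor_op_apply
    by (intro sum.cong refl; cases a)
       (auto simp: sl_E_def lin_ext_bvec cl_xi_bvec cscale_def bvec_apply)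
  also have "\<dots> = (if 0 < k \<and> k - 1 \<le> s then qint p (int s - int (k - 1)) * v (k - 1, flip a) else 0)"
    by (cases "0 < k") auto
  \<comment> \<open>The two ranges differ only at \<open>k = Suc s\<close>, where the coefficient is
    \<open>qint p 0 = 0\<close>: the raising operator annihilates the top vector.\<close>
  also have "\<dots> = (if 0 < k \<and> k \<le> s then qint p (int s - int k + 1) * v (k - 1, flip a) else 0)"
  proof (cases "k = Suc s")
    case False
    then show ?thesis by (auto simp: of_nat_diff algebra_simps)
  qed simp
  finally show ?thesis .
qed

lemma sl_F_bvec_apply: "sl_F p s (bvec j) k = (if j \<le> s \<and> j = Suc k then qint p (int j) else 0)"
  by (cases j) (auto simp: sl_F_def lin_ext_bvec cscale_def bvec_apply)

text \<open>The sign refers to the target ket \<open>a\<close>: on the source \<open>flip a\<close>,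
  \<open>cl_eta\<close> contributes \<open>- \<i> * ksign (flip a)\<close>, which equals
  \<open>\<i> * ksign a\<close>.\<close>

lemma osp_F_apply:
  "osp_F p s v (k, a) = (if k < s then \<i> * ksign a * qint p (int k + 1) * v (k + 1, flip a) else 0)"
proof -
  have "osp_F p s v (k, a) = (\<Sum>j\<le>s. if k + 1 = j then \<i> * ksign a * qint p (int j) * v (j, flip a) else 0)"
    unfolding osp_F_def tensor_op_apply
    by (intro sum.cong refl; cases a)
       (auto simp: sl_F_bvec_apply cl_eta_bvec cscale_def bvec_apply)
  also have "\<dots> = (if k < s then \<i> * ksign a * qint p (int k + 1) * v (k + 1, flip a) else 0)"
    by (auto simp: add.commute)
  finally show ?thesis .
qed

lemma osp_K_apply:
  "osp_K p s v (k, a) = (if k \<le> s then ksign a * p powi (2 * int k - int s) * v (k, a) else 0)"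
proof -
  have "osp_K p s v (k, a) = \<i> * (\<Sum>j\<le>s. if k = j then - \<i> * ksign a * p powi (2 * int j - int s) * v (j, a) else 0)"
    unfolding osp_K_def tensor_op_apply cscale_def
    by (intro arg_cong2[of _ _ _ _ times] sum.cong refl; cases a)
       (auto simp: sl_K_def lin_ext_bvec cl_xi_eta_bvec cscale_def bvec_apply)
  also have "\<dots> = (if k \<le> s then ksign a * p powi (2 * int k - int s) * v (k, a) else 0)"
    by (auto simp: mult.assoc)
  finally show ?thesis .
qed

text \<open>An explicit candidate for the inverse of K that does not mention a carrier, unlike
  \<open>inv_into\<close>. The sign \<open>ksign a\<close> is its own inverse.\<close>

definition osp_K_inv :: "complex \<Rightarrow> nat \<Rightarrow> (nat \<times> ket \<Rightarrow> complex) \<Rightarrow> nat \<times> ket \<Rightarrow> complex" where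
  "osp_K_inv p s v = (\<lambda>(k, a). if k \<le> s then ksign a * p powi (int s - 2 * int k) * v (k, a) else 0)"

lemma osp_linear:
  "osp_E p s (u + v) = osp_E p s u + osp_E p s v" "osp_E p s (c *\<^sub>c v) = c *\<^sub>c osp_E p s v"
  "osp_F p s (u + v) = osp_F p s u + osp_F p s v" "osp_F p s (c *\<^sub>c v) = c *\<^sub>c osp_F p s v"
  "osp_K p s (u + v) = osp_K p s u + osp_K p s v" "osp_K p s (c *\<^sub>c v) = c *\<^sub>c osp_K p s v"
  by (auto simp: fun_eq_iff osp_E_apply osp_F_apply osp_K_apply cscale_def algebra_simps)

section \<open>The module and its graded parts as coordinate subspaces\<close>

lemma W_mod_eq: "W_mod s = coord_subspace ({..s} \<times> UNIV)"
proof -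
  have "UNIV = {Plus, Minus}" using ket.exhaust by auto
  then have "finite (UNIV :: ket set)" by (metis finite.intros)
  moreover have eq: "{tensor (bvec k) (bvec a) |k a. k \<le> s} = bvec ` ({..s} \<times> UNIV)"
    by (auto simp: tensor_bvec)
  ultimately show ?thesis
    unfolding W_mod_def eq by (intro span_bvec) simp
qed

lemma W_even_eq: "W_even s = coord_subspace ({..s} \<times> {Plus})"
proof -
  have "{tensor (bvec k) (bvec Plus) |k. k \<le> s} = bvec ` ({..s} \<times> {Plus})"
    by (auto simp: tensor_bvec)
  then show ?thesis
    by (simp add: W_even_def span_bvec)
qed

lemma W_odd_eq: "W_odd s = coord_subspace ({..s} \<times> {Minus})"
proof -
  have "{tensor (bvec k) (bvec Minus) |k. k \<le> s} = bvec ` ({..s} \<times> {Minus})"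
    by (auto simp: tensor_bvec)
  then show ?thesis
    by (simp add: W_odd_def span_bvec)
qed

section \<open>Graded modules on coordinate subspaces\<close>

text \<open>The scalar form of the sl(2) commutator: for \<open>n = k\<close> and
  \<open>m = s - k\<close>, the products are the coefficients of F E and E F on the basis vector of
  level \<open>k\<close>. On multiplying out with x = p^m and y = p^n, the terms x y p and 1/(x y p)
  cancel, and the rest factors as (x/y - y/x)(p - 1/p).\<close>

lemma qint_mult_diff:
  assumes "p \<noteq> 0" "p ^ 2 \<noteq> 1"
  shows "qint p m * qint p (n + 1) - qint p n * qint p (m + 1) = qint p (m - n)"
proof -
  define x y d where "x = p powi m" and "y = p powi n" and "d = p - inverse p"
  have nz: "x \<noteq> 0" "y \<noteq> 0" "d \<noteq> 0"
    using assms by (auto simp: x_def y_def d_def field_simps power2_eq_square)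
  have q: "qint p m = (x - inverse x) / d" "qint p n = (y - inverse y) / d"
    "qint p (m + 1) = (x * p - inverse (x * p)) / d" "qint p (n + 1) = (y * p - inverse (y * p)) / d"
    "qint p (m - n) = (x / y - y / x) / d"
    using assms(1) by (auto simp: qint_def x_def y_def d_def power_int_add power_int_diff
        power_int_minus field_simps)
  have "(x - inverse x) * (y * p - inverse (y * p)) - (y - inverse y) * (x * p - inverse (x * p))
      = (x / y - y / x) * d"
    using assms(1) nz(1,2) by (simp add: d_def field_simps)
  then have "qint p m * qint p (n + 1) - qint p n * qint p (m + 1) = ((x / y - y / x) * d) / (d * d)"
    unfolding q times_divide_times_eq by (simp only: flip: diff_divide_distrib)
  then show ?thesis
    using nz(3) by (simp add: q)
qed

lemma power_int_2_add: "p \<noteq> 0 \<Longrightarrow> p powi (2 + n) = p ^ 2 * p powi n" for p :: complex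
  by (subst power_int_add) auto

lemma qint_nonzero:
  assumes "p \<noteq> 0" "p ^ 2 \<noteq> 1" "p ^ (2 * n) \<noteq> 1"
  shows "qint p (int n) \<noteq> 0"
proof -
  have "p - inverse p \<noteq> 0"
    using assms(1,2) by (auto simp: field_simps power2_eq_square)
  moreover have "p powi int n - p powi (- int n) \<noteq> 0"
    using assms(1,3) by (auto simp: power_int_minus field_simps simp flip: power_add mult_2)
  ultimately show ?thesis
    by (simp add: qint_def)
qed

text \<open>E joins (k, a) to (k + 1, flip a), F goes back, and K is diagonal. The equivalence
  therefore encodes invariance under all generators, and it covers the full index set as well as
  each summand.\<close>

definition ladder_closed :: "nat \<Rightarrow> (nat \<times> ket) set \<Rightarrow> bool" where
  "ladder_closed s S \<longleftrightarrow> S \<subseteq> {..s} \<times> UNIV \<and>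
     (\<forall>k a. k < s \<longrightarrow> ((k, a) \<in> S \<longleftrightarrow> (k + 1, flip a) \<in> S))"

section \<open>The inverse of K and invariance under the generators\<close>

lemma osp_K_inv_left:
  assumes "p \<noteq> 0" "S \<subseteq> {..s} \<times> UNIV" "v \<in> coord_subspace S"
  shows "osp_K_inv p s (osp_K p s v) = v"
proof
  fix x :: "nat \<times> ket"
  obtain k a where x: "x = (k, a)" by (cases x)
  have "p powi (int s - 2 * int k) * p powi (2 * int k - int s) = 1"
    using assms(1) by (simp flip: power_int_add)
  moreover have "ksign a * P * (ksign a * Q * z) = (ksign a * ksign a) * (P * Q) * z" for P Q z
    by (simp add: algebra_simps)
  ultimately have "osp_K_inv p s (osp_K p s v) x = (if k \<le> s then v x else 0)"
    by (simp only: x osp_K_inv_def osp_K_apply prod.case ksign_simps mult_1_left if_True split: if_split) simp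
  then show "osp_K_inv p s (osp_K p s v) x = v x"
    using assms(2,3) by (auto simp: x coord_subspace_def)
qed

text \<open>Both operators are diagonal and so commute, which reduces the claim to the left
  inverse.\<close>

lemma osp_K_inv_right:
  assumes "p \<noteq> 0" "S \<subseteq> {..s} \<times> UNIV" "v \<in> coord_subspace S"
  shows "osp_K p s (osp_K_inv p s v) = v"
proof -
  have "osp_K p s (osp_K_inv p s v) = osp_K_inv p s (osp_K p s v)"
    by (auto simp: fun_eq_iff osp_K_inv_def osp_K_apply)
  then show ?thesis using osp_K_inv_left[OF assms] by simp
qed

lemma osp_K_coord_subspace: "osp_K p s ` coord_subspace S \<subseteq> coord_subspace S"
  by (auto simp: coord_subspace_def osp_K_apply)

lemma osp_K_inv_coord_subspace: "osp_K_inv p s ` coord_subspace S \<subseteq> coord_subspace S"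
  by (auto simp: coord_subspace_def osp_K_inv_def)

text \<open>Source and target are kept apart because E exchanges the even and odd parts;
  \<open>S = T\<close> gives invariance.\<close>

lemma osp_E_coord_subspace:
  assumes "\<And>k a. k < s \<Longrightarrow> (k, a) \<in> S \<Longrightarrow> (k + 1, flip a) \<in> T"
  shows "osp_E p s ` coord_subspace S \<subseteq> coord_subspace T"
proof -
  have "osp_E p s v (k, a) = 0" if v: "v \<in> coord_subspace S" and ka: "(k, a) \<notin> T" for v k a
  proof (cases "0 < k \<and> k \<le> s")
    case True
    then have "k - 1 < s" "k - 1 + 1 = k" by auto
    then have "(k - 1, flip a) \<notin> S"
      using ka assms[of "k - 1" "flip a"] by auto
    then show ?thesis using v by (auto simp: osp_E_apply coord_subspace_def)
  qed (auto simp: osp_E_apply)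
  then show ?thesis
    by (auto simp: coord_subspace_def)
qed

lemma osp_F_coord_subspace:
  assumes "\<And>k a. k < s \<Longrightarrow> (k + 1, flip a) \<in> S \<Longrightarrow> (k, a) \<in> T"
  shows "osp_F p s ` coord_subspace S \<subseteq> coord_subspace T"
proof -
  have "osp_F p s v (k, a) = 0" if v: "v \<in> coord_subspace S" and ka: "(k, a) \<notin> T" for v k a
    using v ka assms[of k a] by (auto simp: osp_F_apply coord_subspace_def)
  then show ?thesis
    by (auto simp: coord_subspace_def)
qed

lemma osp_K_bij_betw:
  assumes "p \<noteq> 0" "S \<subseteq> {..s} \<times> UNIV"
  shows "bij_betw (osp_K p s) (coord_subspace S) (coord_subspace S)"
  by (rule bij_betw_byWitness[where f' = "osp_K_inv p s"])
    (simp_all add: osp_K_inv_left[OF assms] osp_K_inv_right[OF assms]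
      osp_K_coord_subspace osp_K_inv_coord_subspace)

text \<open>Although \<open>inv_into\<close> depends on the carrier, on each of these spaces it is
  the same diagonal operator. Hence the inverse of K on a module restricts to the one on a
  summand.\<close>

lemma inv_into_osp_K:
  assumes "p \<noteq> 0" "S \<subseteq> {..s} \<times> UNIV" and v: "v \<in> coord_subspace S"
  shows "inv_into (coord_subspace S) (osp_K p s) v = osp_K_inv p s v"
proof (rule inv_into_f_eq)
  show "inj_on (osp_K p s) (coord_subspace S)"
    using osp_K_bij_betw[OF assms(1,2)] by (rule bij_betw_imp_inj_on)
  show "osp_K_inv p s v \<in> coord_subspace S"
    using osp_K_inv_coord_subspace v by (rule subsetD[OF _ imageI])
  show "osp_K p s (osp_K_inv p s v) = v"
    by (rule osp_K_inv_right[OF assms])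
qed

section \<open>The defining relations of the superalgebra\<close>

lemma osp_anticommutator:
  assumes p: "p \<noteq> 0" "p ^ 2 \<noteq> 1" and q: "q = \<i> * p"
  shows "osp_E p s (osp_F p s v) + osp_F p s (osp_E p s v) =
    (1 / (q + inverse q)) *\<^sub>c (osp_K p s v - osp_K_inv p s v)"
proof
  fix x :: "nat \<times> ket"
  obtain k a where x: "x = (k, a)" by (cases x)
  define n m where "n = int k" and "m = int s - int k"
  have d: "p - inverse p \<noteq> 0"
    using p by (auto simp: field_simps power2_eq_square)
  \<comment> \<open>As the inverse of i is -i, the sum for \<open>q\<close> becomes a difference for
    \<open>p\<close>, which is the denominator of \<open>qint p\<close>.\<close>
  have "q + inverse q = \<i> * (p - inverse p)"
    by (simp add: q algebra_simps)
  moreover have "1 / (\<i> * z) = - \<i> / z" for z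
    by (cases "z = 0") (auto simp: field_simps)
  ultimately have inv: "1 / (q + inverse q) = - \<i> / (p - inverse p)"
    by metis
  show "(osp_E p s (osp_F p s v) + osp_F p s (osp_E p s v)) x =
    ((1 / (q + inverse q)) *\<^sub>c (osp_K p s v - osp_K_inv p s v)) x"
  proof (cases "k \<le> s")
    case True
    \<comment> \<open>Moving \<open>ksign\<close> past one flip gives E F and F E opposite signs, so
      their sum carries the sl(2) commutator. At the ends, \<open>k = 0\<close> here and
      \<open>k = s\<close> for F E, the operator value 0 agrees with the formula because
      \<open>qint p 0 = 0\<close>.\<close>
    have E: "osp_E p s (osp_F p s v) (k, a) = - \<i> * ksign a * (qint p n * qint p (m + 1)) * v (k, a)"
      using True by (cases k) (auto simp: osp_E_apply osp_F_apply n_def m_def algebra_simps)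
    have F: "osp_F p s (osp_E p s v) (k, a) = \<i> * ksign a * (qint p m * qint p (n + 1)) * v (k, a)"
      using True by (cases "k = s") (auto simp: osp_E_apply osp_F_apply n_def m_def algebra_simps)
    have "(osp_E p s (osp_F p s v) + osp_F p s (osp_E p s v)) x =
        \<i> * ksign a * (qint p m * qint p (n + 1) - qint p n * qint p (m + 1)) * v (k, a)"
      unfolding x plus_fun_apply E F by (simp add: algebra_simps)
    also have "\<dots> = \<i> * ksign a * qint p (m - n) * v (k, a)"
      by (simp only: qint_mult_diff[OF p])
    also have "\<dots> = ((1 / (q + inverse q)) *\<^sub>c (osp_K p s v - osp_K_inv p s v)) x"
      using True unfolding inv x cscale_def
      by (simp add: osp_K_apply osp_K_inv_def qint_def n_def m_def algebra_simps diff_divide_distrib)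
    finally show ?thesis .
  \<comment> \<open>Beyond level \<open>s\<close> every operator has value 0, so the relation holds
    for arbitrary functions and not only on the module.\<close>
  qed (simp add: x osp_E_apply osp_F_apply osp_K_apply osp_K_inv_def cscale_def)
qed

text \<open>Raising the level by one multiplies the eigenvalue of K by p^2, and flipping the ket
  multiplies it by -1; together this is -p^2 = q^2. The relation with F is the same computation with
  inverse factors.\<close>

lemma osp_K_E:
  assumes p: "p \<noteq> 0" and q: "q = \<i> * p"
  shows "osp_K p s (osp_E p s v) = (q powi 2) *\<^sub>c osp_E p s (osp_K p s v)"
proof
  fix x :: "nat \<times> ket"
  obtain k a where x: "x = (k, a)" by (cases x)
  show "osp_K p s (osp_E p s v) x = ((q powi 2) *\<^sub>c osp_E p s (osp_K p s v)) x"
  proof (cases "0 < k \<and> k \<le> s")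
    case True
    then have "2 * int k - int s = 2 + (2 * int (k - 1) - int s)" by auto
    then have "p powi (2 * int k - int s) = p ^ 2 * p powi (2 * int (k - 1) - int s)"
      by (simp only: power_int_2_add[OF p])
    moreover have "q powi 2 = - (p ^ 2)"
      by (simp add: q power_mult_distrib)
    moreover have "k - 1 \<le> s" using True by linarith
    ultimately show ?thesis
      using True unfolding x cscale_def osp_E_apply osp_K_apply by (simp add: algebra_simps)
  qed (auto simp: x osp_E_apply osp_K_apply cscale_def)
qed

lemma osp_K_F:
  assumes p: "p \<noteq> 0" and q: "q = \<i> * p"
  shows "osp_K p s (osp_F p s v) = (q powi (-2)) *\<^sub>c osp_F p s (osp_K p s v)"
proof
  fix x :: "nat \<times> ket"
  obtain k a where x: "x = (k, a)" by (cases x)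
  show "osp_K p s (osp_F p s v) x = ((q powi (-2)) *\<^sub>c osp_F p s (osp_K p s v)) x"
  proof (cases "k < s")
    case True
    have "2 * int (k + 1) - int s = 2 + (2 * int k - int s)" by auto
    then have P: "p powi (2 * int (k + 1) - int s) = p ^ 2 * p powi (2 * int k - int s)"
      by (simp only: power_int_2_add[OF p])
    have Q: "q powi (-2) = - inverse (p ^ 2)"
      by (simp add: q power_mult_distrib power_int_minus)
    show ?thesis
      using True p unfolding x cscale_def osp_F_apply osp_K_apply P Q by (simp add: field_simps)
  qed (auto simp: x osp_F_apply osp_K_apply cscale_def)
qed

text \<open>Stated for every closed index set so that it applies to the whole module and to each
  summand. The grading splits \<open>S\<close> by ket, and E and F exchange the two halves because
  they flip it.\<close>

lemma uq_osp_module_coord_subspace: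
  assumes p: "p \<noteq> 0" "p ^ 2 \<noteq> 1" and q: "q = \<i> * p" and S: "ladder_closed s S"
  shows "uq_osp_module q (coord_subspace S) (coord_subspace S \<inter> W_even s) (coord_subspace S \<inter> W_odd s)
    (osp_E p s) (osp_F p s) (osp_K p s)"
proof -
  have S': "S \<subseteq> {..s} \<times> UNIV" using S by (simp add: ladder_closed_def)
  have SE: "(Suc k, flip a) \<in> S" if "(k, a) \<in> S" "k < s" for k a
    using S that by (auto simp: ladder_closed_def)
  have SF: "(k, a) \<in> S" if "(Suc k, flip a) \<in> S" "k < s" for k a
    using S that by (auto simp: ladder_closed_def)
  have "a = Plus \<or> a = Minus" for a by (cases a) auto
  then have "S = (S \<inter> {..s} \<times> {Plus}) \<union> (S \<inter> {..s} \<times> {Minus})"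
    using S' by blast
  then have graded: "direct_sum_decomp (coord_subspace S) (coord_subspace S \<inter> W_even s) (coord_subspace S \<inter> W_odd s)"
    unfolding W_even_eq W_odd_eq coord_subspace_Int by (rule direct_sum_coord_subspace) auto
  have flipD: "a = Minus" if "flip a = Plus" for a using that by (cases a) auto
  have flipD': "a = Plus" if "flip a = Minus" for a using that by (cases a) auto
  have E: "osp_E p s ` (coord_subspace S \<inter> W_even s) \<subseteq> coord_subspace S \<inter> W_odd s"
    "osp_E p s ` (coord_subspace S \<inter> W_odd s) \<subseteq> coord_subspace S \<inter> W_even s"
    unfolding W_even_eq W_odd_eq coord_subspace_Int
    by (intro osp_E_coord_subspace; auto dest: SE)+
  have F: "osp_F p s ` (coord_subspace S \<inter> W_even s) \<subseteq> coord_subspace S \<inter> W_odd s"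
    "osp_F p s ` (coord_subspace S \<inter> W_odd s) \<subseteq> coord_subspace S \<inter> W_even s"
    unfolding W_even_eq W_odd_eq coord_subspace_Int
    by (intro osp_F_coord_subspace; auto dest: SF flipD flipD')+
  have K: "osp_K p s ` (coord_subspace S \<inter> W_even s) \<subseteq> coord_subspace S \<inter> W_even s"
    "osp_K p s ` (coord_subspace S \<inter> W_odd s) \<subseteq> coord_subspace S \<inter> W_odd s"
    unfolding W_even_eq W_odd_eq coord_subspace_Int by (rule osp_K_coord_subspace)+
  show ?thesis
    unfolding uq_osp_module_def
    by (intro conjI ballI graded E F K osp_K_bij_betw[OF p(1) S'] osp_K_E[OF p(1) q] osp_K_F[OF p(1) q])
       (simp_all add: linear_on_space_def osp_linear inv_into_osp_K[OF p(1) S'] osp_anticommutator[OF p q])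
qed

lemma uq_submodule_coord_subspace:
  assumes p: "p \<noteq> 0" and S: "ladder_closed s S" and T: "T \<subseteq> {..s} \<times> UNIV" "S \<subseteq> T"
  shows "uq_submodule (coord_subspace S) (coord_subspace T) (osp_E p s) (osp_F p s) (osp_K p s)"
proof -
  have sub: "coord_subspace S \<subseteq> coord_subspace T"
    using T(2) by (auto simp: coord_subspace_def)
  have "inv_into (coord_subspace T) (osp_K p s) ` coord_subspace S = osp_K_inv p s ` coord_subspace S"
    using sub by (intro image_cong refl inv_into_osp_K[OF p T(1)]) auto
  then have "inv_into (coord_subspace T) (osp_K p s) ` coord_subspace S \<subseteq> coord_subspace S"
    by (simp add: osp_K_inv_coord_subspace)
  moreover have "osp_E p s ` coord_subspace S \<subseteq> coord_subspace S"
    using S by (intro osp_E_coord_subspace) (auto simp: ladder_closed_def)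
  moreover have "osp_F p s ` coord_subspace S \<subseteq> coord_subspace S"
    using S by (intro osp_F_coord_subspace) (auto simp: ladder_closed_def)
  ultimately show ?thesis
    using sub by (simp add: uq_submodule_def subspace_coord_subspace osp_K_coord_subspace)
qed

section \<open>The two summands\<close>

text \<open>Starting from (s, a), each application of F lowers the level by one and flips the ket,
  which produces this parity pattern.\<close>

definition ladder :: "nat \<Rightarrow> ket \<Rightarrow> (nat \<times> ket) set" where
  "ladder s a = {(k, c). k \<le> s \<and> (c = a \<longleftrightarrow> even (s - k))}"

lemma ladder_closed_UNIV: "ladder_closed s ({..s} \<times> UNIV)"
  by (auto simp: ladder_closed_def)

lemma flip_eq_iff: "flip c = a \<longleftrightarrow> c \<noteq> a"
  by (cases c; cases a) auto

lemma ladder_closed_ladder: "ladder_closed s (ladder s a)"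
  by (auto simp: ladder_closed_def ladder_def flip_eq_iff)

text \<open>Each level carries exactly one ket, which yields finiteness, the cardinality, and the
  power of F that reaches a given index.\<close>

lemma ladder_eq_image: "ladder s a = (\<lambda>k. (k, if even (s - k) then a else flip a)) ` {..s}"
proof -
  have "c \<noteq> a \<Longrightarrow> c = flip a" for c by (cases c; cases a) auto
  then show ?thesis by (auto simp: ladder_def image_iff split: if_splits)
qed

lemma finite_ladder: "finite (ladder s a)"
  by (simp add: ladder_eq_image)

lemma card_ladder: "card (ladder s a) = s + 1"
  unfolding ladder_eq_image by (subst card_image) (auto simp: inj_on_def)

lemma flip_eq_flip: "flip c = a \<longleftrightarrow> c = flip a"
  by auto

text \<open>Only the nonvanishing of the constant matters. Each step multiplies it by a unit times
  \<open>qint p (int (s - j))\<close>, and \<open>s - j\<close> stays between 1 and \<open>s\<close>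
  as long as \<open>j < s\<close>.\<close>

lemma osp_F_pow_hw_vec:
  assumes nz: "\<And>n. 1 \<le> n \<Longrightarrow> n \<le> s \<Longrightarrow> qint p (int n) \<noteq> 0" and "j \<le> s"
  shows "\<exists>c. c \<noteq> 0 \<and>
    (osp_F p s ^^ j) (hw_vec s a) = c *\<^sub>c bvec (s - j, if even j then a else flip a)"
  using \<open>j \<le> s\<close>
proof (induction j)
  case 0
  then show ?case by (intro exI[of _ 1]) (simp add: hw_vec_def tensor_bvec)
next
  case (Suc j)
  define a' where "a' = (if even j then a else flip a)"
  obtain c where c: "c \<noteq> 0" "(osp_F p s ^^ j) (hw_vec s a) = c *\<^sub>c bvec (s - j, a')"
    using Suc by (auto simp: a'_def)
  \<comment> \<open>The factor \<open>- \<i> * ksign a'\<close> comes from \<open>cl_eta\<close> on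
    the source ket, the q-number from the lowering operator at level \<open>s - j\<close>.\<close>
  define d where "d = - \<i> * ksign a' * qint p (int (s - j))"
  have "osp_F p s (bvec (s - j, a')) = d *\<^sub>c bvec (s - Suc j, flip a')"
    using Suc.prems
    by (auto simp: fun_eq_iff osp_F_apply bvec_def cscale_def d_def flip_eq_flip of_nat_diff)
  then have "(osp_F p s ^^ Suc j) (hw_vec s a) = (c * d) *\<^sub>c bvec (s - Suc j, flip a')"
    by (simp add: c osp_linear)
  moreover have "c * d \<noteq> 0"
    using c nz[of "s - j"] Suc.prems by (simp add: d_def)
  ultimately show ?case
    by (intro exI[of _ "c * d"]) (simp add: a'_def)
qed

text \<open>The powers of F up to \<open>s\<close> run through the ladder from the top and give a
  nonzero multiple of each of its basis vectors; level \<open>k\<close> is reached by the power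
  \<open>s - k\<close>.\<close>

lemma W_summand_eq:
  assumes nz: "\<And>n. 1 \<le> n \<Longrightarrow> n \<le> s \<Longrightarrow> qint p (int n) \<noteq> 0"
  shows "W_summand p s a = coord_subspace (ladder s a)"
proof
  have "(osp_F p s ^^ j) (hw_vec s a) \<in> coord_subspace (ladder s a)" if j: "j \<le> s" for j
  proof -
    have "(s - j, if even j then a else flip a) \<in> ladder s a"
      using j by (auto simp: ladder_def)
    then show ?thesis
      using osp_F_pow_hw_vec[where a = a, OF nz j]
      by (metis bvec_in_coord_subspace cfun.subspace_scale subspace_coord_subspace)
  qed
  then show "W_summand p s a \<subseteq> coord_subspace (ladder s a)"
    unfolding W_summand_def by (intro cfun.span_minimal subspace_coord_subspace) auto
  have "bvec x \<in> W_summand p s a" if "x \<in> ladder s a" for x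
  proof -
    obtain k where "k \<in> {..s}" and x: "x = (k, if even (s - k) then a else flip a)"
      using \<open>x \<in> ladder s a\<close> unfolding ladder_eq_image by (rule imageE)
    then have k: "s - (s - k) = k" by simp
    obtain c where "c \<noteq> 0" "(osp_F p s ^^ (s - k)) (hw_vec s a) = c *\<^sub>c bvec x"
      using osp_F_pow_hw_vec[where a = a and j = "s - k", OF nz diff_le_self] unfolding k x by blast
    then have "bvec x = inverse c *\<^sub>c (osp_F p s ^^ (s - k)) (hw_vec s a)"
      by simp
    also have "\<dots> \<in> W_summand p s a"
      unfolding W_summand_def
      by (intro cfun.span_scale cfun.span_base CollectI exI[of _ "s - k"]) simp
    finally show ?thesis .
  qed
  then show "coord_subspace (ladder s a) \<subseteq> W_summand p s a"
    unfolding span_bvec[OF finite_ladder, symmetric] W_summand_def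
    by (intro cfun.span_minimal cfun.subspace_span) auto
qed

section \<open>Highest weight vectors and irreducibility\<close>

lemma hw_vec_in_W_summand: "hw_vec s a \<in> W_summand p s a"
  unfolding W_summand_def by (intro cfun.span_base CollectI exI[of _ 0]) simp

lemma hw_vec_nonzero: "hw_vec s a \<noteq> 0"
proof
  assume "hw_vec s a = 0"
  then have "hw_vec s a (s, a) = 0" by simp
  then show False by (simp add: hw_vec_def tensor_bvec bvec_apply)
qed

text \<open>Induction on the lowest occurring level \<open>k\<close>, from \<open>s\<close>
  downwards, with \<open>v\<close> general: applying E replaces \<open>v\<close> by a vector of
  \<open>U\<close> whose lowest level is \<open>Suc k\<close>.\<close>

lemma hw_vec_in_submodule:
  assumes nz: "\<And>n. 1 \<le> n \<Longrightarrow> n \<le> s \<Longrightarrow> qint p (int n) \<noteq> 0"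
    and U: "cfun.subspace U" "U \<subseteq> coord_subspace (ladder s a)" "osp_E p s ` U \<subseteq> U"
    and v: "v \<in> U" "v (k, c) \<noteq> 0" "\<And>j d. j < k \<Longrightarrow> v (j, d) = 0"
  shows "hw_vec s a \<in> U"
proof -
  have supp: "(j, d) \<in> ladder s a" if "u \<in> U" "u (j, d) \<noteq> 0" for u j d
    using U(2) that by (auto simp: coord_subspace_def)
  have "k \<le> s" using supp[OF v(1,2)] by (simp add: ladder_def)
  then show ?thesis using v
  proof (induction k arbitrary: v c rule: inc_induct)
    case base
    \<comment> \<open>Everything below level \<open>s\<close> vanishes by assumption, and the ladder
      contains only (s, a) at level \<open>s\<close>.\<close>
    have "v = v (s, c) *\<^sub>c bvec (s, a)"
    proof
      fix x :: "nat \<times> ket"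
      obtain j d where x: "x = (j, d)" by (cases x)
      have "c = a" using supp[OF base(1,2)] by (simp add: ladder_def)
      moreover have "v (j, d) = 0" if "(j, d) \<noteq> (s, a)"
      proof (rule ccontr)
        assume "v (j, d) \<noteq> 0"
        then have "(j, d) \<in> ladder s a" "\<not> j < s" using supp base by auto
        then show False using that by (auto simp: ladder_def)
      qed
      ultimately show "v x = (v (s, c) *\<^sub>c bvec (s, a)) x"
        by (auto simp: x cscale_def bvec_def)
    qed
    then have "bvec (s, a) = inverse (v (s, c)) *\<^sub>c v"
      using base(2) by (metis cfun.scale_scale cfun.scale_one left_inverse)
    then show ?case
      using base(1) U(1) by (simp add: hw_vec_def tensor_bvec cfun.subspace_scale)
  next
    case (step k)
    have "osp_E p s v \<in> U" using step U(3) by auto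
    \<comment> \<open>The coefficient produced by E at level \<open>Suc k\<close> is the q-number of
      \<open>s - k\<close>, which is nonzero because \<open>k < s\<close>.\<close>
    moreover have "int s - int (Suc k) + 1 = int (s - k)" using step by auto
    then have "osp_E p s v (Suc k, flip c) \<noteq> 0"
      using step nz[of "s - k"] by (simp only: osp_E_apply) simp
    moreover have "osp_E p s v (j, d) = 0" if "j < Suc k" for j d
      using that step.prems(3)[of "j - 1"] by (auto simp: osp_E_apply)
    ultimately show ?case using step.IH by blast
  qed
qed

lemma uq_irreducible_W_summand:
  assumes nz: "\<And>n. 1 \<le> n \<Longrightarrow> n \<le> s \<Longrightarrow> qint p (int n) \<noteq> 0"
  shows "uq_irreducible (W_summand p s a) (osp_E p s) (osp_F p s) (osp_K p s)"
proof -
  have "U = W_summand p s a"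
    if U: "uq_submodule U (W_summand p s a) (osp_E p s) (osp_F p s) (osp_K p s)" and "U \<noteq> {0}" for U
  proof -
    have sub: "cfun.subspace U" "U \<subseteq> W_summand p s a" "osp_E p s ` U \<subseteq> U" "osp_F p s ` U \<subseteq> U"
      using U by (auto simp: uq_submodule_def)
    obtain v where v: "v \<in> U" "v \<noteq> 0"
      using \<open>U \<noteq> {0}\<close> cfun.subspace_0[OF sub(1)] by auto
    \<comment> \<open>The lowest level at which \<open>v\<close> is nonzero, as
      \<open>hw_vec_in_submodule\<close> requires.\<close>
    define k where "k = (LEAST k. \<exists>c. v (k, c) \<noteq> 0)"
    have "\<exists>k c. v (k, c) \<noteq> 0" using v(2) by (auto simp: fun_eq_iff)
    then have "\<exists>c. v (k, c) \<noteq> 0"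
      unfolding k_def by (rule LeastI_ex)
    then obtain c where c: "v (k, c) \<noteq> 0" ..
    have least: "v (j, d) = 0" if "j < k" for j d
      using not_less_Least[of j "\<lambda>k. \<exists>c. v (k, c) \<noteq> 0"] that by (auto simp: k_def)
    have "W_summand p s a = coord_subspace (ladder s a)"
      by (rule W_summand_eq[OF nz])
    then have supp: "U \<subseteq> coord_subspace (ladder s a)"
      using sub(2) by simp
    have hw: "hw_vec s a \<in> U"
      by (rule hw_vec_in_submodule[OF nz sub(1) supp sub(3) v(1) c least])
    have "(osp_F p s ^^ j) (hw_vec s a) \<in> U" for j
      by (induction j) (use hw sub(4) in auto)
    then have "W_summand p s a \<subseteq> U"
      unfolding W_summand_def by (intro cfun.span_minimal sub(1)) auto
    then show ?thesis using sub(2) by auto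
  qed
  then show ?thesis
    using hw_vec_in_W_summand hw_vec_nonzero unfolding uq_irreducible_def by blast
qed

lemma highest_weight_vector_hw_vec:
  "highest_weight_vector (W_summand p s a) (osp_E p s) (osp_K p s) (hw_vec s a)"
proof -
  have "osp_E p s (hw_vec s a) = 0"
    by (auto simp: hw_vec_def tensor_bvec bvec_apply fun_eq_iff osp_E_apply)
  \<comment> \<open>The weight is the parity sign of the ket times the eigenvalue of the sl(2)
    generator K at level \<open>k = s\<close>.\<close>
  moreover have "osp_K p s (hw_vec s a) = (ksign a * p powi int s) *\<^sub>c hw_vec s a"
    by (auto simp: hw_vec_def tensor_bvec bvec_apply fun_eq_iff osp_K_apply cscale_def)
  ultimately show ?thesis
    using hw_vec_in_W_summand hw_vec_nonzero unfolding highest_weight_vector_def by blast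
qed


section \<open>Assembling the decomposition from the two ladders\<close>

theorem mainTheorem2:
  fixes b b_star q q_star :: complex and s :: nat
  assumes "b ^ 2 = b_star ^ 2 + 1 / 2"
    and "q = exp (of_real pi * \<i> * b ^ 2)"
    and "q_star = - \<i> * q"
    and "q_star ^ 2 \<noteq> 1"
    and "\<forall>n\<in>{1..s}. q_star ^ (2 * n) \<noteq> 1"
  shows
    "let E = osp_E q_star s; F = osp_F q_star s; K = osp_K q_star s;
         W = W_mod s; W0 = W_even s; W1 = W_odd s;
         Wp = W_summand q_star s Plus; Wm = W_summand q_star s Minus;
         wp = hw_vec s Plus; wm = hw_vec s Minus
     in uq_osp_module q W W0 W1 E F K \<and>
        uq_submodule Wp W E F K \<and> uq_submodule Wm W E F K \<and>
        uq_osp_module q Wp (Wp \<inter> W0) (Wp \<inter> W1) E F K \<and>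
        uq_osp_module q Wm (Wm \<inter> W0) (Wm \<inter> W1) E F K \<and>
        direct_sum_decomp W Wp Wm \<and>
        highest_weight_vector Wp E K wp \<and> highest_weight_vector Wm E K wm \<and>
        uq_irreducible Wp E F K \<and> uq_irreducible Wm E F K \<and>
        cfun.dim Wp = cfun.dim Wm \<and>
        wp \<in> W0 \<and> wm \<in> W1"
proof -
  let ?p = q_star
  have p: "?p \<noteq> 0" using assms(2,3) by simp
  have q: "q = \<i> * ?p" using assms(3) by simp
  have nz: "qint ?p (int n) \<noteq> 0" if "1 \<le> n" "n \<le> s" for n
    using qint_nonzero[OF p assms(4)] assms(5) that by auto
  have Wa: "W_summand ?p s a = coord_subspace (ladder s a)" for a
    by (rule W_summand_eq) (use nz in auto)
  \<comment> \<open>The general module lemma takes graded parts as intersections with the carrier;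
    for the full index set these are the graded parts themselves.\<close>
  have inter: "W_mod s \<inter> W_even s = W_even s" "W_mod s \<inter> W_odd s = W_odd s"
    unfolding W_mod_eq W_even_eq W_odd_eq coord_subspace_Int
    by (auto intro!: arg_cong[of _ _ coord_subspace])
  have W: "uq_osp_module q (W_mod s) (W_even s) (W_odd s) (osp_E ?p s) (osp_F ?p s) (osp_K ?p s)"
    using uq_osp_module_coord_subspace[OF p assms(4) q ladder_closed_UNIV, of s]
    by (simp add: inter flip: W_mod_eq)
  have sub: "uq_submodule (W_summand ?p s a) (W_mod s) (osp_E ?p s) (osp_F ?p s) (osp_K ?p s)" for a
    unfolding Wa W_mod_eq
    by (rule uq_submodule_coord_subspace[OF p ladder_closed_ladder]) (auto simp: ladder_def)
  have graded: "uq_osp_module q (W_summand ?p s a) (W_summand ?p s a \<inter> W_even s)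
      (W_summand ?p s a \<inter> W_odd s) (osp_E ?p s) (osp_F ?p s) (osp_K ?p s)" for a
    unfolding Wa by (rule uq_osp_module_coord_subspace[OF p assms(4) q ladder_closed_ladder])
  \<comment> \<open>At each level the two ladders use opposite kets, so they partition the index
    set.\<close>
  have "{..s} \<times> UNIV = ladder s Plus \<union> ladder s Minus" "ladder s Plus \<inter> ladder s Minus = {}"
    using ket.exhaust by (auto simp: ladder_def)
  then have decomp: "direct_sum_decomp (W_mod s) (W_summand ?p s Plus) (W_summand ?p s Minus)"
    unfolding Wa W_mod_eq by (rule direct_sum_coord_subspace)
  have dim: "cfun.dim (W_summand ?p s a) = s + 1" for a
    unfolding Wa by (simp add: dim_coord_subspace finite_ladder card_ladder)
  have parity: "hw_vec s Plus \<in> W_even s" "hw_vec s Minus \<in> W_odd s"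
    unfolding W_even_eq W_odd_eq hw_vec_def tensor_bvec by (auto intro: bvec_in_coord_subspace)
  show ?thesis
    unfolding Let_def
    by (intro conjI W sub graded decomp highest_weight_vector_hw_vec uq_irreducible_W_summand nz parity)
       (simp_all add: dim)
qed

end
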